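(* Let $\Omega\ge 1$, $a>0$, $K\ge \frac54+\frac{3\Omega}{4}$, and let $$\kappa=\frac{1}{\left(2\Omega+1+\frac{2(\Omega+1)^2}{2\Omega+1}(K+a)\right)^2}.$$ Let $\epsilon$ be a real number with $$\epsilon<\min\left\{\frac{1-(2\Omega+3)\kappa-(\Omega+1)(1-\kappa)e^{-4K/9}}{2(\Omega+1)},\; a\sqrt{\kappa}\right\}.$$ Let $(\rho,p,q,\lambda,\mu)$ be a static shell solution of the spherically symmetric Einstein equations (as defined in the context) with $\rho\ge 0$, $p\ge 0$ and $p+q\le\Omega\rho$, whose matter is supported in $[R_0,R_1]$, $0<R_0<R_1$, and suppose that $R_1/R_0\le 1+\epsilon$. Let $m(r)=\int_0^r 4\pi\eta^2\rho(\eta)\,d\eta$ and let $M=\int_0^\infty 4\pi\eta^2\rho(\eta)\,d\eta$ be the ADM mass. Then $$\frac{2M}{R_1}\le 1-\kappa,$$ and, if in addition $\epsilon\le\kappa/2$, then $$\sup_{r>0}\frac{2m(r)}{r}\le 1-\frac{\kappa}{2}.$$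
   Context: The metric of a static spherically symmetric spacetime in Schwarzschild coordinates is $ds^2=-e^{2\mu(r)}dt^2+e^{2\lambda(r)}dr^2+r^2(d\theta^2+\sin^2\theta\,d\varphi^2)$, $r\ge 0$. A static shell solution supported in $[R_0,R_1]$ (with $0<R_0<R_1$) consists of real-valued functions $\rho$ (energy density), $p$ (radial pressure), $q$ (tangential pressure, normalized so that isotropic pressure means $q=2p$), and metric functions $\lambda,\mu$ on $[0,\infty)$, with $\lambda\in C^1$, $\mu\in C^2$ and $\rho,p,q$ continuous, such that $\rho,p,q$ vanish outside $[R_0,R_1]$ and the Einstein equations hold for all $r>0$ (subscript $r$ denotes $d/dr$): $$e^{-2\lambda}(2r\lambda_r-1)+1=8\pi r^2\rho,$$ $$e^{-2\lambda}(2r\mu_r+1)-1=8\pi r^2p,$$ $$\mu_{rr}+(\mu_r-\lambda_r)\left(\mu_r+\frac1r\right)=4\pi q e^{2\lambda},$$ together with the asymptotic flatness conditions $\lim_{r\to\infty}\lambda(r)=\lim_{r\to\infty}\mu(r)=0$ and the regular centre condition $\lambda(0)=0$. No field equations for the matter are assumed beyond these. *)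

theory Defs
  imports "HOL-Analysis.Analysis"
begin

text \<open>
  All functions of the areal radius are modelled as total functions on the reals of which only the
  values on the half-line \<open>[0, \<infinity>)\<close> matter.  Accordingly derivatives are taken within \<open>{0..}\<close>, i.e.
  they are one-sided at the centre and ordinary derivatives at every positive radius.  They are
  thereby unique, so the existentially quantified derivatives in
  \<open>static_shell_solution\<close> are the derivatives of \<open>lam\<close> and \<open>\<mu>\<close>.
\<close>

definition has_C1_derivative :: "(real \<Rightarrow> real) \<Rightarrow> (real \<Rightarrow> real) \<Rightarrow> bool" where
  "has_C1_derivative f f' \<longleftrightarrow>
     (\<forall>r\<ge>0. (f has_real_derivative f' r) (at r within {0..})) \<and> continuous_on {0..} f'"

definition static_shell_solution ::
  "real \<Rightarrow> real \<Rightarrow> (real \<Rightarrow> real) \<Rightarrow> (real \<Rightarrow> real) \<Rightarrow> (real \<Rightarrow> real) \<Rightarrow>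
   (real \<Rightarrow> real) \<Rightarrow> (real \<Rightarrow> real) \<Rightarrow> bool" where
  "static_shell_solution R\<^sub>0 R\<^sub>1 \<rho> p q lam \<mu> \<longleftrightarrow>
     0 < R\<^sub>0 \<and> R\<^sub>0 < R\<^sub>1 \<and>
     continuous_on {0..} \<rho> \<and> continuous_on {0..} p \<and> continuous_on {0..} q \<and>
     (\<forall>r\<ge>0. r \<notin> {R\<^sub>0..R\<^sub>1} \<longrightarrow> \<rho> r = 0 \<and> p r = 0 \<and> q r = 0) \<and>
     (\<exists>lam' \<mu>' \<mu>''.
        has_C1_derivative lam lam' \<and>
        has_C1_derivative \<mu> \<mu>' \<and> has_C1_derivative \<mu>' \<mu>'' \<and>
        (\<forall>r>0.
           exp (- 2 * lam r) * (2 * r * lam' r - 1) + 1 = 8 * pi * r\<^sup>2 * \<rho> r \<and>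
           exp (- 2 * lam r) * (2 * r * \<mu>' r + 1) - 1 = 8 * pi * r\<^sup>2 * p r \<and>
           \<mu>'' r + (\<mu>' r - lam' r) * (\<mu>' r + 1 / r) = 4 * pi * q r * exp (2 * lam r))) \<and>
     (lam \<longlongrightarrow> 0) at_top \<and> (\<mu> \<longlongrightarrow> 0) at_top \<and>
     lam 0 = 0"

definition mass_function :: "(real \<Rightarrow> real) \<Rightarrow> real \<Rightarrow> real" where
  "mass_function \<rho> r = integral {0..r} (\<lambda>\<eta>. 4 * pi * \<eta>\<^sup>2 * \<rho> \<eta>)"

definition ADM_mass :: "(real \<Rightarrow> real) \<Rightarrow> real" where
  "ADM_mass \<rho> = integral {0..} (\<lambda>\<eta>. 4 * pi * \<eta>\<^sup>2 * \<rho> \<eta>)"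

end

theory Submission
  imports Defs
begin

text \<open>
  With \<open>c = 2\<Omega> + 1\<close> we have \<open>\<kappa> \<le> 1/c\<^sup>2\<close>, so the sharp bound \<open>2m(r)/r \<le> 1 - 1/c\<^sup>2\<close> suffices.
  The first field equation gives \<open>2m(r)/r = 1 - s\<^sup>2\<close> with \<open>s = e\<^sup>-\<^sup>\<lambda> \<le> 1\<close>.  Consider
  \<open>w = s (2r\<mu>\<^sub>r + 1 + c) = (1 + 8\<pi>r\<^sup>2p)/s + cs\<close>, which equals \<open>c + 1\<close> at the centre.
  Under the field equations the condition \<open>p + q \<le> \<Omega>\<rho>\<close> reads
  \<open>2 s r w\<^sub>r \<le> c + 1 - cs\<^sup>2 - (w - cs)\<^sup>2\<close>; at \<open>w = c + 1\<close> the right-hand side is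
  \<open>-c(c + 1)(1 - s)\<^sup>2\<close>, and it decreases in \<open>w\<close> for \<open>w \<ge> c + 1\<close>.  Hence \<open>w\<close> never exceeds \<open>c + 1\<close>.
  As \<open>p \<ge> 0\<close>, this gives \<open>1/s + cs \<le> c + 1\<close>, that is \<open>(1 - s)(1 - cs) \<le> 0\<close>, so \<open>s \<ge> 1/c\<close>.
\<close>

text \<open>Let \<open>t\<close> be the last point of the interval with \<open>w t \<le> C\<close>.
  If \<open>t < b\<close>, then \<open>w\<close> stays at or above \<open>C\<close> after
  \<open>t\<close>, so it is nonincreasing there and \<open>w b \<le> w t \<le> C\<close>.\<close>

lemma barrier_le:
  fixes w w' :: "real \<Rightarrow> real"
  assumes "a \<le> b" and cont: "continuous_on {a..b} w" and start: "w a \<le> C"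
    and deriv: "\<And>r. a < r \<Longrightarrow> r < b \<Longrightarrow> (w has_real_derivative w' r) (at r)"
    and barrier: "\<And>r. a < r \<Longrightarrow> r < b \<Longrightarrow> w r \<ge> C \<Longrightarrow> w' r \<le> 0"
  shows "w b \<le> C"
proof (rule ccontr)
  assume "\<not> w b \<le> C"
  define S where "S = {a..b} \<inter> w -` {..C}"
  have "compact S"
    unfolding S_def compact_eq_bounded_closed
    using continuous_closed_preimage[OF cont] bounded_subset[OF bounded_closed_interval] by blast
  moreover have "a \<in> S"
    using assms(1) start by (simp add: S_def)
  ultimately obtain t where t: "t \<in> S" and t_max: "\<And>r. r \<in> S \<Longrightarrow> r \<le> t"
    using compact_attains_sup[of S] by blast
  with \<open>\<not> w b \<le> C\<close> have tb: "a \<le> t" "t < b" "w t \<le> C"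
    by (auto simp: S_def less_le)
  have above: "w r \<ge> C" if "t < r" "r < b" for r
    using that tb t_max[of r] by (force simp: S_def)
  have "w b \<le> w t"
  proof (rule DERIV_nonpos_imp_decreasing_open[of t b w])
    show "continuous_on {t..b} w"
      using cont tb by (auto intro: continuous_on_subset)
    show "\<exists>y. (w has_real_derivative y) (at r) \<and> y \<le> 0" if "t < r" "r < b" for r
      using deriv barrier above[OF that] tb that by (meson le_less_trans)
  qed (use tb in simp)
  with tb \<open>\<not> w b \<le> C\<close> show False by simp
qed

lemma has_real_derivative_at_of_half_line:
  assumes "(f has_real_derivative D) (at r within {0..})" and "r > 0"
  shows "(f has_real_derivative D) (at (r::real))"
proof -
  have "at r within {0..} = at r"
    using \<open>r > 0\<close> by (intro at_within_interior) simp
  with assms show ?thesis by simp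
qed

lemma has_C1_derivative_continuous_on:
  assumes "has_C1_derivative f f'"
  shows "continuous_on {0..r} f"
proof -
  have "(f has_real_derivative f' x) (at x within {0..})" if "x \<in> {0..}" for x
    using assms that unfolding has_C1_derivative_def by simp
  then have "continuous_on {0..} f"
    by (rule DERIV_continuous_on)
  then show ?thesis
    by (rule continuous_on_subset) simp
qed

text \<open>By the first field equation, \<open>r * (1 - exp (- 2 * lam r)) / 2\<close> is an
  antiderivative of the mass density, and its factor \<open>r\<close> makes it vanish at the
  centre.\<close>

lemma metric_mass_relation:
  assumes lam: "has_C1_derivative lam lam'" and "r \<ge> 0"
    and eq: "\<And>r. r > 0 \<Longrightarrow> exp (- 2 * lam r) * (2 * r * lam' r - 1) + 1 = 8 * pi * r\<^sup>2 * \<rho> r"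
  shows "2 * mass_function \<rho> r = r * (1 - exp (- 2 * lam r))"
    and "(\<lambda>\<eta>. 4 * pi * \<eta>\<^sup>2 * \<rho> \<eta>) integrable_on {0..r}"
proof -
  define f where "f r = r * (1 - exp (- 2 * lam r)) / 2" for r
  have cont: "continuous_on {0..r} lam"
    using lam by (rule has_C1_derivative_continuous_on)
  have "((\<lambda>\<eta>. 4 * pi * \<eta>\<^sup>2 * \<rho> \<eta>) has_integral f r - f 0) {0..r}"
  \<comment> \<open>At the centre \<open>lam\<close> has only a one-sided derivative, so
    differentiability is used in the open interval and continuity up to its ends.\<close>
  proof (rule fundamental_theorem_of_calculus_interior)
    show "continuous_on {0..r} f"
      unfolding f_def by (intro continuous_intros cont) simp
    fix x assume x: "x \<in> {0<..<r}"
    then have [derivative_intros]: "(lam has_real_derivative lam' x) (at x)"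
      using lam by (intro has_real_derivative_at_of_half_line) (auto simp: has_C1_derivative_def)
    have "(f has_real_derivative
        (1 - exp (- 2 * lam x) + x * (2 * lam' x * exp (- 2 * lam x))) / 2) (at x)"
      unfolding f_def by (auto intro!: derivative_eq_intros)
    also have "(1 - exp (- 2 * lam x) + x * (2 * lam' x * exp (- 2 * lam x))) / 2
        = (exp (- 2 * lam x) * (2 * x * lam' x - 1) + 1) / 2"
      by (simp add: algebra_simps)
    also have "\<dots> = 4 * pi * x\<^sup>2 * \<rho> x"
      using eq[of x] x by simp
    finally have "(f has_real_derivative 4 * pi * x\<^sup>2 * \<rho> x) (at x)" .
    then show "(f has_vector_derivative 4 * pi * x\<^sup>2 * \<rho> x) (at x)"
      by (simp add: has_real_derivative_iff_has_vector_derivative)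
  qed (fact \<open>r \<ge> 0\<close>)
  then show "2 * mass_function \<rho> r = r * (1 - exp (- 2 * lam r))"
    and "(\<lambda>\<eta>. 4 * pi * \<eta>\<^sup>2 * \<rho> \<eta>) integrable_on {0..r}"
    by (auto simp: mass_function_def f_def dest: integral_unique)
qed

text \<open>Here \<open>u\<close>, \<open>v\<close>, \<open>z\<close> stand for \<open>r\<lambda>\<^sub>r\<close>, \<open>r\<mu>\<^sub>r\<close>, \<open>r\<^sup>2\<mu>\<^sub>r\<^sub>r\<close>, and the conclusion is \<open>r w\<^sub>r \<le> 0\<close>.\<close>

lemma barrier_inequality:
  fixes s u v z \<Omega> :: real
  assumes "\<Omega> \<ge> 1" and s: "0 < s" "s \<le> 1"
    and dom: "s\<^sup>2 * (2 * v + 1) - 1 + 2 * s\<^sup>2 * (z + (v - u) * (v + 1))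
                \<le> \<Omega> * (s\<^sup>2 * (2 * u - 1) + 1)"
    and above: "s * (2 * v + 2 * \<Omega> + 2) \<ge> 2 * \<Omega> + 2"
  shows "s * (2 * v + 2 * z - u * (2 * v + 2 * \<Omega> + 2)) \<le> 0"
proof -
  define W where "W = s * (2 * v + 2 * z - u * (2 * v + 2 * \<Omega> + 2))"
  define c where "c = 2 * \<Omega> + 1"
  \<comment> \<open>\<open>Y\<close> is w - cs in the notation of the overview.\<close>
  define Y where "Y = s * (2 * v + 1)"
  have "Y \<ge> c + 1 - c * s"
    using above by (simp add: Y_def c_def algebra_simps)
  \<comment> \<open>The lower bound for \<open>Y\<close> may be squared only because it is
    nonnegative.\<close>
  moreover have "c + 1 - c * s \<ge> 0"
    using s \<open>\<Omega> \<ge> 1\<close> mult_left_le[of s c] unfolding c_def by linarith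
  ultimately have Y: "Y\<^sup>2 \<ge> (c + 1 - c * s)\<^sup>2"
    by (simp add: power_mono)
  \<comment> \<open>This is twice \<open>dom\<close> rearranged: the terms with \<open>z\<close> or
    \<open>u\<close> add up to \<open>2 * s * W\<close>, and the remaining terms in \<open>v\<close>
    complete the square in \<open>Y\<close>.\<close>
  have "2 * s * W \<le> c + 1 - c * s\<^sup>2 - Y\<^sup>2"
    using dom by (simp add: W_def c_def Y_def power2_eq_square algebra_simps)
  also have "\<dots> \<le> c + 1 - c * s\<^sup>2 - (c + 1 - c * s)\<^sup>2"
    using Y by simp
  also have "\<dots> = - (c * (c + 1) * (1 - s)\<^sup>2)"
    by (simp add: power2_eq_square algebra_simps)
  also have "\<dots> \<le> 0"
    using \<open>\<Omega> \<ge> 1\<close> by (simp add: c_def)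
  finally have "s * W \<le> 0" by linarith
  with s have "W \<le> 0" by (simp add: mult_le_0_iff)
  then show ?thesis by (simp add: W_def)
qed

lemma static_shell_mass_integrable:
  assumes "static_shell_solution R\<^sub>0 R\<^sub>1 \<rho> p q lam \<mu>" and "r \<ge> 0"
  shows "(\<lambda>\<eta>. 4 * pi * \<eta>\<^sup>2 * \<rho> \<eta>) integrable_on {0..r}"
  using assms metric_mass_relation(2)[of lam _ r \<rho>]
  unfolding static_shell_solution_def by metis

theorem static_shell_sharp_bound:
  assumes shell: "static_shell_solution R\<^sub>0 R\<^sub>1 \<rho> p q lam \<mu>" and \<Omega>: "\<Omega> \<ge> 1"
    and \<rho>: "\<forall>r\<ge>0. \<rho> r \<ge> 0" and p: "\<forall>r\<ge>0. p r \<ge> 0"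
    and dom: "\<forall>r\<ge>0. p r + q r \<le> \<Omega> * \<rho> r" and "r > 0"
  shows "2 * mass_function \<rho> r / r \<le> 1 - 1 / (2 * \<Omega> + 1)\<^sup>2"
proof -
  obtain lam' \<mu>' \<mu>'' where lam: "has_C1_derivative lam lam'" and "lam 0 = 0"
    and \<mu>': "has_C1_derivative \<mu>' \<mu>''"
    and eq\<rho>: "\<And>r. r > 0 \<Longrightarrow>
      exp (- 2 * lam r) * (2 * r * lam' r - 1) + 1 = 8 * pi * r\<^sup>2 * \<rho> r"
    and eqp: "\<And>r. r > 0 \<Longrightarrow>
      exp (- 2 * lam r) * (2 * r * \<mu>' r + 1) - 1 = 8 * pi * r\<^sup>2 * p r"
    and eqq: "\<And>r. r > 0 \<Longrightarrow>
      \<mu>'' r + (\<mu>' r - lam' r) * (\<mu>' r + 1 / r) = 4 * pi * q r * exp (2 * lam r)"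
    using shell unfolding static_shell_solution_def by auto
  define s where "s r = exp (- lam r)" for r
  have s2: "exp (- 2 * lam r) = (s r)\<^sup>2" for r
    by (simp add: s_def flip: exp_double)
  have s_pos: "s r > 0" for r
    by (simp add: s_def)
  have mass: "2 * mass_function \<rho> r = r * (1 - (s r)\<^sup>2)" if "r \<ge> 0" for r
    using metric_mass_relation(1)[OF lam that eq\<rho>] s2 by metis
  have s_le_1: "s r \<le> 1" if "r > 0" for r
  proof -
    have "mass_function \<rho> r \<ge> 0"
      unfolding mass_function_def
      by (rule integral_nonneg[OF static_shell_mass_integrable[OF shell]]) (use \<rho> that in auto)
    with mass[of r] that have "(s r)\<^sup>2 \<le> 1"
      by (smt (verit) zero_le_mult_iff)
    then show ?thesis
      using power2_le_imp_le[of "s r" 1] by simp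
  qed
  define w where "w r = s r * (2 * r * \<mu>' r + 2 * \<Omega> + 2)" for r
  define w' where "w' r = s r * (2 * \<mu>' r + 2 * r * \<mu>'' r)
    - lam' r * s r * (2 * r * \<mu>' r + 2 * \<Omega> + 2)" for r
  have cont: "continuous_on {0..r} lam" "continuous_on {0..r} \<mu>'"
    using lam \<mu>' by (auto intro: has_C1_derivative_continuous_on)
  have "w r \<le> 2 * \<Omega> + 2"
  proof (rule barrier_le[of 0 r w _ w'])
    show "continuous_on {0..r} w"
      unfolding w_def s_def by (intro continuous_intros cont)
    show "w 0 \<le> 2 * \<Omega> + 2"
      by (simp add: w_def s_def \<open>lam 0 = 0\<close>)
    fix x :: real assume x: "0 < x"
    have [derivative_intros]: "(lam has_real_derivative lam' x) (at x)"
        "(\<mu>' has_real_derivative \<mu>'' x) (at x)"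
      using lam \<mu>' x
      by (auto simp: has_C1_derivative_def intro: has_real_derivative_at_of_half_line)
    show "(w has_real_derivative w' x) (at x)"
      unfolding w_def w'_def s_def
      by (rule derivative_eq_intros refl)+ (simp add: algebra_simps)
    assume above: "w x \<ge> 2 * \<Omega> + 2"
    \<comment> \<open>Multiplying the third field equation by
      \<open>2 * (s x)\<^sup>2 * x\<^sup>2\<close> clears \<open>1 / x\<close>, cancels the
      exponential, and gives \<open>q\<close> the same factor as \<open>p\<close> and
      \<open>\<rho>\<close> in the other two equations.\<close>
    have "x\<^sup>2 * \<mu>'' x + (x * \<mu>' x - x * lam' x) * (x * \<mu>' x + 1)
        = x\<^sup>2 * (\<mu>'' x + (\<mu>' x - lam' x) * (\<mu>' x + 1 / x))"
      using x by (simp add: field_simps power2_eq_square)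
    then have "2 * (s x)\<^sup>2 * (x\<^sup>2 * \<mu>'' x + (x * \<mu>' x - x * lam' x) * (x * \<mu>' x + 1))
        = 8 * pi * x\<^sup>2 * q x * ((s x)\<^sup>2 * exp (2 * lam x))"
      by (simp add: eqq[OF x] mult_ac)
    also have "(s x)\<^sup>2 * exp (2 * lam x) = 1"
      by (simp flip: s2 exp_add)
    finally have tangential:
      "2 * (s x)\<^sup>2 * (x\<^sup>2 * \<mu>'' x + (x * \<mu>' x - x * lam' x) * (x * \<mu>' x + 1))
        = 8 * pi * x\<^sup>2 * q x" by simp
    have "8 * pi * x\<^sup>2 * (p x + q x) \<le> 8 * pi * x\<^sup>2 * (\<Omega> * \<rho> x)"
      using dom x by (intro mult_left_mono) auto
    then have "8 * pi * x\<^sup>2 * p x + 8 * pi * x\<^sup>2 * q x \<le> \<Omega> * (8 * pi * x\<^sup>2 * \<rho> x)"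
      by (simp add: algebra_simps)
    \<comment> \<open>Reading the field equations from right to left removes all matter terms and
      turns the energy condition into the hypothesis \<open>dom\<close> of
      \<open>barrier_inequality\<close>.\<close>
    then have "s x * (2 * (x * \<mu>' x) + 2 * (x\<^sup>2 * \<mu>'' x)
        - (x * lam' x) * (2 * (x * \<mu>' x) + 2 * \<Omega> + 2)) \<le> 0"
      using above unfolding eqp[OF x, symmetric] eq\<rho>[OF x, symmetric] tangential[symmetric] s2 w_def
      by (intro barrier_inequality[OF \<Omega> s_pos s_le_1[OF x]]) (simp_all add: mult.assoc)
    also have "s x * (2 * (x * \<mu>' x) + 2 * (x\<^sup>2 * \<mu>'' x)
        - (x * lam' x) * (2 * (x * \<mu>' x) + 2 * \<Omega> + 2)) = x * w' x"
      by (simp add: w'_def algebra_simps power2_eq_square)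
    finally show "w' x \<le> 0"
      using x by (simp add: mult_le_0_iff)
  qed (use \<open>r > 0\<close> in auto)
  moreover have "(s r)\<^sup>2 * (2 * r * \<mu>' r + 1) \<ge> 1"
    using eqp[OF \<open>r > 0\<close>] p \<open>r > 0\<close> unfolding s2
    by (smt (verit) mult_nonneg_nonneg pi_ge_zero zero_le_power2)
  \<comment> \<open>Multiply \<open>w r \<le> 2 * \<Omega> + 2\<close> by \<open>s r\<close>; the
    left side is then 1 + 8 pi r^2 p + c s^2, and \<open>p\<close> is nonnegative.\<close>
  ultimately have "1 + (2 * \<Omega> + 1) * (s r)\<^sup>2 \<le> s r * (2 * \<Omega> + 2)"
    using mult_left_mono[of "w r" "2 * \<Omega> + 2" "s r"] s_pos[of r]
    by (simp add: w_def power2_eq_square algebra_simps)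
  then have "(1 - s r) * (1 - (2 * \<Omega> + 1) * s r) \<le> 0"
    by (simp add: power2_eq_square algebra_simps)
  \<comment> \<open>For \<open>s r = 1\<close> the product vanishes and says nothing about its
    second factor; there the bound follows from c >= 1.\<close>
  moreover have "s r = 1 \<Longrightarrow> (2 * \<Omega> + 1) * s r \<ge> 1"
    using \<Omega> by simp
  ultimately have "(2 * \<Omega> + 1) * s r \<ge> 1"
    using s_le_1[OF \<open>r > 0\<close>] by (auto simp: mult_le_0_iff)
  then have "s r \<ge> 1 / (2 * \<Omega> + 1)"
    using \<Omega> by (simp add: field_simps)
  then have "(s r)\<^sup>2 \<ge> 1 / (2 * \<Omega> + 1)\<^sup>2"
    using \<Omega> power_mono[of "1 / (2 * \<Omega> + 1)" "s r" 2] by (simp add: power_divide)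
  with mass[of r] \<open>r > 0\<close> show ?thesis by simp
qed

text \<open>The density vanishes beyond the outer radius, so the integrand may be cut off
  there.\<close>

lemma ADM_mass_eq:
  assumes "static_shell_solution R\<^sub>0 R\<^sub>1 \<rho> p q lam \<mu>"
  shows "ADM_mass \<rho> = mass_function \<rho> R\<^sub>1"
  unfolding ADM_mass_def mass_function_def
proof -
  let ?f = "\<lambda>\<eta>. 4 * pi * \<eta>\<^sup>2 * \<rho> \<eta>"
  have "integral {0..} ?f = integral {0..} (\<lambda>\<eta>. if \<eta> \<in> {0..R\<^sub>1} then ?f \<eta> else 0)"
    using assms unfolding static_shell_solution_def by (intro integral_cong) auto
  also have "\<dots> = integral ({0..R\<^sub>1} \<inter> {0..}) ?f"
    by (rule integral_restrict_Int)
  also have "{0..R\<^sub>1} \<inter> {0..} = {0..R\<^sub>1}"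
    by auto
  finally show "integral {0..} ?f = integral {0..R\<^sub>1} ?f" .
qed

theorem theorem1:
  fixes \<Omega> a K \<kappa> \<epsilon> R\<^sub>0 R\<^sub>1 :: real
    and \<rho> p q lam \<mu> :: "real \<Rightarrow> real"
  assumes "\<Omega> \<ge> 1" and "a > 0" and "K \<ge> 5/4 + 3 * \<Omega> / 4"
    and "\<kappa> = 1 / (2 * \<Omega> + 1 + 2 * (\<Omega> + 1)\<^sup>2 / (2 * \<Omega> + 1) * (K + a))\<^sup>2"
    and "\<epsilon> < min ((1 - (2 * \<Omega> + 3) * \<kappa> - (\<Omega> + 1) * (1 - \<kappa>) * exp (- (4 * K / 9)))
                    / (2 * (\<Omega> + 1)))
                 (a * sqrt \<kappa>)"
    and "static_shell_solution R\<^sub>0 R\<^sub>1 \<rho> p q lam \<mu>"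
    and "\<forall>r\<ge>0. \<rho> r \<ge> 0" and "\<forall>r\<ge>0. p r \<ge> 0"
    and "\<forall>r\<ge>0. p r + q r \<le> \<Omega> * \<rho> r"
    and "R\<^sub>1 / R\<^sub>0 \<le> 1 + \<epsilon>"
  shows "2 * ADM_mass \<rho> / R\<^sub>1 \<le> 1 - \<kappa> \<and>
         (\<epsilon> \<le> \<kappa> / 2 \<longrightarrow>
           (SUP r\<in>{0<..}. ereal (2 * mass_function \<rho> r / r)) \<le> ereal (1 - \<kappa> / 2))"
proof -
  \<comment> \<open>Since \<open>K + a\<close> is positive, the base of the square in
    \<open>\<kappa>\<close> is at least \<open>2 * \<Omega> + 1\<close>.\<close>
  have \<kappa>: "\<kappa> \<le> 1 / (2 * \<Omega> + 1)\<^sup>2"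
  proof -
    have "2 * (\<Omega> + 1)\<^sup>2 / (2 * \<Omega> + 1) * (K + a) \<ge> 0"
      using assms(1-3) by simp
    then show ?thesis
      unfolding assms(4) using assms(1) by (intro divide_left_mono power_mono) auto
  qed
  have "\<kappa> \<ge> 0"
    unfolding assms(4) by simp
  have bound: "2 * mass_function \<rho> r / r \<le> 1 - \<kappa>" if "r > 0" for r
    using static_shell_sharp_bound[OF assms(6,1,7-9) that] \<kappa> by linarith
  have "R\<^sub>1 > 0"
    using assms(6) unfolding static_shell_solution_def by linarith
  then have "2 * ADM_mass \<rho> / R\<^sub>1 \<le> 1 - \<kappa>"
    using bound ADM_mass_eq[OF assms(6)] by simp
  moreover have "2 * mass_function \<rho> r / r \<le> 1 - \<kappa> / 2" if "r > 0" for r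
    using bound[OF that] \<open>\<kappa> \<ge> 0\<close> by simp
  ultimately show ?thesis
    by (auto intro: SUP_least)
qed

end
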